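(* Let $I=[a,b]\subset\mathbb{R}$ be a compact interval and let $\{f_k\}_{k=1}^\infty$ be a monotone sequence of Sequential Henstock integrable functions $f_k:I\to\mathbb{R}$ that converges pointwise to a limit function $f:I\to\mathbb{R}$. If $\lim_{k\to\infty}\int_I f_k$ exists (as a real number), then $f$ is Sequential Henstock integrable on $I$ and $$\int_I f=\lim_{k\to\infty}\int_I f_k.$$
   Context: A sequence of functions $\{f_k\}$ on $I$ is monotone if it is non-decreasing ($f_k(x)\le f_{k+1}(x)$ for all $k$ and all $x\in I$) or non-increasing ($f_k(x)\ge f_{k+1}(x)$ for all $k$ and all $x\in I$). A tagged partition $P=\{([x_{i-1},x_i],t_i)\}_{i=1}^m$ of $I=[a,b]$ consists of points $a=x_0<x_1<\dots<x_m=b$ together with tags $t_i\in[x_{i-1},x_i]$. Its Riemann sum for $f$ is $S(f,P)=\sum_{i=1}^m f(t_i)(x_i-x_{i-1})$. A gauge on $I$ is a function $\delta:I\to\mathbb{R}$ with $\delta(x)>0$ for all $x\in I$. $P$ is $\delta(x)$-fine if $x_i-x_{i-1}<\delta(t_i)$ for every $i$. $f$ is Sequential Henstock integrable on $I$ with integral $A=\int_I f\in\mathbb{R}$ if there is a sequence of gauges $\{\delta_n\}_{n=1}^\infty$ on $I$ such that, whenever $P_n$ is a $\delta_n(x)$-fine tagged partition of $I$ for each $n$, one has $S(f,P_n)\to A$ as $n\to\infty$. The value of the integral is unique. *)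

theory Defs
  imports Complex_Main
begin

(* (m, x, t): m subintervals, division points x 0, ..., x m and tags t 1, ..., t m.
   The values of x and t at other indices are irrelevant. *)
type_synonym tagged_partition = "nat \<times> (nat \<Rightarrow> real) \<times> (nat \<Rightarrow> real)"

(* m = 0 is possible only for a = b, so that the integral over a degenerate interval
   is 0 rather than arbitrary. *)
definition tagged_partition_of :: "tagged_partition \<Rightarrow> real \<Rightarrow> real \<Rightarrow> bool" where
  "tagged_partition_of P a b \<longleftrightarrow>
     (case P of (m, x, t) \<Rightarrow>
        x 0 = a \<and> x m = b \<and>
        (\<forall>i\<in>{1..m}. x (i - 1) < x i \<and> t i \<in> {x (i - 1)..x i}))"

definition riemann_sum :: "(real \<Rightarrow> real) \<Rightarrow> tagged_partition \<Rightarrow> real" where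
  "riemann_sum f P = (case P of (m, x, t) \<Rightarrow> \<Sum>i=1..m. f (t i) * (x i - x (i - 1)))"

definition gauge_fun :: "(real \<Rightarrow> real) \<Rightarrow> real \<Rightarrow> real \<Rightarrow> bool" where
  "gauge_fun \<delta> a b \<longleftrightarrow> (\<forall>x\<in>{a..b}. 0 < \<delta> x)"

definition gauge_fine :: "(real \<Rightarrow> real) \<Rightarrow> tagged_partition \<Rightarrow> bool" where
  "gauge_fine \<delta> P \<longleftrightarrow> (case P of (m, x, t) \<Rightarrow> \<forall>i\<in>{1..m}. x i - x (i - 1) < \<delta> (t i))"

definition has_seq_henstock_integral ::
    "(real \<Rightarrow> real) \<Rightarrow> real \<Rightarrow> real \<Rightarrow> real \<Rightarrow> bool" where
  "has_seq_henstock_integral f A a b \<longleftrightarrow>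
     (\<exists>\<delta> :: nat \<Rightarrow> real \<Rightarrow> real.
        (\<forall>n. gauge_fun (\<delta> n) a b) \<and>
        (\<forall>P :: nat \<Rightarrow> tagged_partition.
           (\<forall>n. tagged_partition_of (P n) a b \<and> gauge_fine (\<delta> n) (P n)) \<longrightarrow>
           (\<lambda>n. riemann_sum f (P n)) \<longlonglongrightarrow> A))"

definition seq_henstock_integrable :: "(real \<Rightarrow> real) \<Rightarrow> real \<Rightarrow> real \<Rightarrow> bool" where
  "seq_henstock_integrable f a b \<longleftrightarrow> (\<exists>A. has_seq_henstock_integral f A a b)"

definition seq_henstock_integral :: "(real \<Rightarrow> real) \<Rightarrow> real \<Rightarrow> real \<Rightarrow> real" where
  "seq_henstock_integral f a b = (THE A. has_seq_henstock_integral f A a b)"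

definition monotone_fun_seq :: "(nat \<Rightarrow> real \<Rightarrow> real) \<Rightarrow> real \<Rightarrow> real \<Rightarrow> bool" where
  "monotone_fun_seq f a b \<longleftrightarrow>
     (\<forall>k. \<forall>x\<in>{a..b}. f k x \<le> f (Suc k) x) \<or>
     (\<forall>k. \<forall>x\<in>{a..b}. f k x \<ge> f (Suc k) x)"

end

theory Submission
  imports Defs "HOL-Analysis.Henstock_Kurzweil_Integration"
begin

text \<open>
  On a compact interval, sequential Henstock integrability is the same as Henstock--Kurzweil
  integrability, with the same value; the theorem is then the monotone convergence theorem for
  the Henstock--Kurzweil integral.

  One direction of the equivalence is a choice of gauges: if the Henstock--Kurzweil definition
  supplies a gauge for each \<open>\<epsilon>\<close>, then the gauges for \<open>\<epsilon> = 1 / (n + 1)\<close> form a sequence as required.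
  Conversely, in a sequence of gauges that witnesses sequential integrability, some single gauge
  already forces all its fine Riemann sums to be \<open>\<epsilon>\<close>-close to the integral: otherwise, picking a
  bad fine partition for every index would give a sequence of Riemann sums that does not converge
  (\<open>has_seq_henstock_integral_uniformly_close\<close>).

  What is left is to match the two notions of a partition. Here a partition is an increasing list
  of points, while a tagged division is a finite unordered set of tagged, possibly degenerate
  intervals. The set of cells of a partition is a tagged division, and conversely the
  nondegenerate members of a tagged division can be lined up as the cells of a partition
  (\<open>tagged_division_to_partition\<close>). Riemann sums depend on the cells only, and degenerate
  cells contribute nothing to them.
\<close>

section \<open>Partitions as sets of tagged cells\<close>

definition cells :: "tagged_partition \<Rightarrow> (real \<times> real set) set" where
  "cells P = (case P of (m, x, t) \<Rightarrow> (\<lambda>i. (t i, {x (i - 1)..x i})) ` {1..m})"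

lemma division_points_strict_mono:
  assumes "tagged_partition_of (m, x, t) a b" and "i < j" and "j \<le> m"
  shows "x i < x j"
  using assms(2,3)
proof (induction j)
  case (Suc j)
  have "x j < x (Suc j)"
    using assms(1) Suc.prems(2) by (force simp: tagged_partition_of_def)
  then show ?case
    using Suc by (cases "i = j") auto
qed simp

lemma division_points_mono:
  assumes "tagged_partition_of (m, x, t) a b" and "i \<le> j" and "j \<le> m"
  shows "x i \<le> x j"
  using division_points_strict_mono[OF assms(1), of i j] assms(2,3)
  by (cases "i = j") auto

text \<open>Distinct indices have distinct right endpoints, so no cell is counted twice when a sum over
  indices is turned into a sum over the set of cells.\<close>

lemma inj_on_cells:
  assumes "tagged_partition_of (m, x, t) a b"
  shows "inj_on (\<lambda>i. (t i, {x (i - 1)..x i})) {1..m}"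
proof (rule inj_onI)
  fix i j assume ij: "i \<in> {1..m}" "j \<in> {1..m}"
    and eq: "(t i, {x (i - 1)..x i}) = (t j, {x (j - 1)..x j})"
  have "x (i - 1) < x i"
    using assms ij by (auto simp: tagged_partition_of_def)
  then have "x i = x j"
    using eq by (simp add: Icc_eq_Icc)
  then show "i = j"
    using division_points_strict_mono[OF assms, of i j]
      division_points_strict_mono[OF assms, of j i] ij
    by (cases i j rule: linorder_cases) auto
qed

lemma riemann_sum_eq_sum_cells:
  assumes "tagged_partition_of P a b"
  shows "riemann_sum f P = (\<Sum>(t, K)\<in>cells P. content K *\<^sub>R f t)"
proof -
  obtain m x t where P: "P = (m, x, t)"
    by (cases P)
  have inj: "inj_on (\<lambda>i. (t i, {x (i - 1)..x i})) {1..m}"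
    using inj_on_cells assms unfolding P .
  have len: "x (i - 1) \<le> x i" if "i \<in> {1..m}" for i
    using assms that by (force simp: P tagged_partition_of_def)
  show ?thesis
    using len unfolding P cells_def riemann_sum_def prod.case sum.reindex[OF inj]
    by (intro sum.cong) auto
qed

lemma gauge_fine_iff_cells:
  assumes "tagged_partition_of P a b"
  shows "gauge_fine \<delta> P \<longleftrightarrow> (\<forall>(t, K)\<in>cells P. content K < \<delta> t)"
proof -
  obtain m x t where P: "P = (m, x, t)"
    by (cases P)
  have "x (i - 1) \<le> x i" if "i \<in> {1..m}" for i
    using assms that by (force simp: P tagged_partition_of_def)
  then show ?thesis
    by (auto simp: P cells_def gauge_fine_def)
qed

text \<open>The inequality \<open>a < b\<close> has to be strict: for \<open>a = b\<close> the only partition has no cells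
  and does not cover the point \<open>a\<close>.\<close>

lemma cells_tagged_division_of:
  assumes P: "tagged_partition_of P a b" and "a < b"
  shows "cells P tagged_division_of {a..b}"
proof -
  obtain m x t where mxt: "P = (m, x, t)"
    by (cases P)
  have part: "tagged_partition_of (m, x, t) a b"
    using P by (simp add: mxt)
  then have ends: "x 0 = a" "x m = b"
    and tag: "\<And>i. i \<in> {1..m} \<Longrightarrow> t i \<in> {x (i - 1)..x i}"
    by (auto simp: tagged_partition_of_def)
  have sub: "{x (i - 1)..x i} \<subseteq> {a..b}" if "i \<in> {1..m}" for i
    using division_points_mono[OF part, of 0 "i - 1"] division_points_mono[OF part, of i m] that ends
    by auto
  have disj: "{x (i - 1)<..<x i} \<inter> {x (j - 1)<..<x j} = {}"
    if "i < j" "j \<in> {1..m}" for i j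
  proof -
    have "x i \<le> x (j - 1)"
      using division_points_mono[OF part, of i "j - 1"] that by auto
    then show ?thesis
      by auto
  qed
  have cover: "\<exists>i\<in>{1..m}. y \<in> {x (i - 1)..x i}" if y: "y \<in> {a..b}" for y
  proof (cases "y = a")
    case True
    have "m \<noteq> 0"
      using ends \<open>a < b\<close> by (cases m) auto
    then show ?thesis
      using True ends division_points_mono[OF part, of 0 1] by (intro bexI[of _ 1]) auto
  next
    case False
    \<comment> \<open>The cell containing \<open>y\<close> ends at the first division point that is not to the left of \<open>y\<close>.\<close>
    define i where "i = (LEAST i. y \<le> x i)"
    have "y \<le> x m"
      using y ends by simp
    then have i: "y \<le> x i" "i \<le> m"
      unfolding i_def by (auto intro: LeastI Least_le)
    then have "i \<noteq> 0"
      using False y ends by (cases i) auto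
    then have "\<not> y \<le> x (i - 1)"
      unfolding i_def by (intro not_less_Least) auto
    then show ?thesis
      using i \<open>i \<noteq> 0\<close> by (intro bexI[of _ i]) auto
  qed
  show ?thesis
  proof (rule tagged_division_ofI)
    show "finite (cells P)"
      by (simp add: cells_def mxt)
  next
    fix s K assume "(s, K) \<in> cells P"
    then obtain i where "i \<in> {1..m}" "s = t i" "K = {x (i - 1)..x i}"
      by (auto simp: cells_def mxt)
    then show "s \<in> K" "K \<subseteq> {a..b}" "\<exists>u v. K = cbox u v"
      using tag sub by (auto simp flip: box_real)
  next
    fix s K s' K' assume "(s, K) \<in> cells P" "(s', K') \<in> cells P" and ne: "(s, K) \<noteq> (s', K')"
    then obtain i j where i: "i \<in> {1..m}" "(s, K) = (t i, {x (i - 1)..x i})"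
        and j: "j \<in> {1..m}" "(s', K') = (t j, {x (j - 1)..x j})"
      unfolding cells_def mxt prod.case by (elim imageE) (rule that)
    with ne have "i \<noteq> j"
      by metis
    then have "{x (i - 1)<..<x i} \<inter> {x (j - 1)<..<x j} = {}"
      using disj[of i j] disj[of j i] i(1) j(1) by (metis Int_commute linorder_neqE_nat)
    moreover have "K = {x (i - 1)..x i}" "K' = {x (j - 1)..x j}"
      using i(2) j(2) by simp_all
    ultimately show "interior K \<inter> interior K' = {}"
      by (simp only: interior_atLeastAtMost_real)
  next
    have "{K. \<exists>s. (s, K) \<in> cells P} = (\<lambda>i. {x (i - 1)..x i}) ` {1..m}"
      unfolding cells_def mxt prod.case by blast
    moreover have "(\<Union>i\<in>{1..m}. {x (i - 1)..x i}) = {a..b}"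
      using cover by (intro equalityI UN_least sub subsetI UN_iff[THEN iffD2])
    ultimately show "\<Union> {K. \<exists>s. (s, K) \<in> cells P} = {a..b}"
      by (simp only:)
  qed
qed

section \<open>Ordering a tagged division\<close>

text \<open>
  For finitely many closed subintervals of \<open>[a, b]\<close> with disjoint interiors, covering \<open>[a, b]\<close> is equivalent to having total length
  \<open>b - a\<close>; stated through lengths, the claim can be proved by induction along the right
  endpoints. If \<open>[u, v]\<close> is the rightmost interval, disjointness pushes all others into \<open>[a, u]\<close>, so
  their total length is at most \<open>u - a\<close>. Total length \<open>b - a\<close> then forces \<open>v = b\<close> and equality for the
  others, which by induction form a partition of \<open>[a, u]\<close> to which \<open>[u, b]\<close> is appended. The
  inequality is part of the statement because this step needs it.
\<close>

lemma disjoint_intervals_form_partition: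
  fixes D :: "(real \<times> real set) set"
  assumes "finite D" and "a \<le> b"
    and "\<And>t K. (t, K) \<in> D \<Longrightarrow> \<exists>u v. a \<le> u \<and> u < v \<and> v \<le> b \<and> K = {u..v} \<and> t \<in> K"
    and "\<And>t K t' K'. (t, K) \<in> D \<Longrightarrow> (t', K') \<in> D \<Longrightarrow> (t, K) \<noteq> (t', K') \<Longrightarrow>
           interior K \<inter> interior K' = {}"
  shows "(\<Sum>(t, K)\<in>D. content K) \<le> b - a \<and>
         ((\<Sum>(t, K)\<in>D. content K) = b - a \<longrightarrow>
           (\<exists>P. tagged_partition_of P a b \<and> cells P = D))"
  using assms
proof (induction D arbitrary: b rule: finite_ranking_induct[where f = "\<lambda>(t, K). Sup K"])
  case empty
  have "tagged_partition_of (0, \<lambda>_. a, \<lambda>_. a) a a" "cells (0, \<lambda>_. a, \<lambda>_. a) = {}"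
    by (auto simp: tagged_partition_of_def cells_def)
  then show ?case
    using \<open>a \<le> b\<close> by auto
next
  case (insert c S)
  show ?case
  proof (cases "c \<in> S")
    case True
    then show ?thesis
      using insert by (simp add: insert_absorb)
  next
    case False
    obtain t u v where c: "c = (t, {u..v})" and uv: "a \<le> u" "u < v" "v \<le> b" "t \<in> {u..v}"
      using insert.prems(2)[of "fst c" "snd c"] by (cases c) auto
    have S: "\<exists>u' v'. a \<le> u' \<and> u' < v' \<and> v' \<le> u \<and> K = {u'..v'} \<and> s \<in> K"
      if sK: "(s, K) \<in> S" for s K
    proof -
      obtain u' v' where K: "a \<le> u'" "u' < v'" "K = {u'..v'}" "s \<in> K"
        using insert.prems(2)[of s K] sK by auto
      have "v' \<le> v"
        using insert.hyps(2)[OF sK] K(2,3) uv(2) by (simp add: c)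
      moreover have "interior K \<inter> interior {u..v} = {}"
      proof (rule insert.prems(3))
        show "(s, K) \<noteq> (t, {u..v})"
          using sK False unfolding c by metis
      qed (use sK c in simp_all)
      then have "{u'<..<v'} \<inter> {u<..<v} = {}"
        unfolding K(3) interior_atLeastAtMost_real .
      then have "\<not> (max u u' < min v v')"
        using dense[of "max u u'" "min v v'"] by auto
      ultimately have "v' \<le> u"
        using K(2) uv(2) by auto
      then show ?thesis
        using K by blast
    qed
    have IH: "(\<Sum>(t, K)\<in>S. content K) \<le> u - a"
      "(\<Sum>(t, K)\<in>S. content K) = u - a \<Longrightarrow> \<exists>P. tagged_partition_of P a u \<and> cells P = S"
      using insert.IH[OF \<open>a \<le> u\<close> S] insert.prems(3) by blast+
    have total: "(\<Sum>(t, K)\<in>insert c S. content K) = (v - u) + (\<Sum>(t, K)\<in>S. content K)"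
      using insert.hyps(1) False uv(2) by (simp add: c)
    show ?thesis
    proof (intro conjI impI)
      show "(\<Sum>(t, K)\<in>insert c S. content K) \<le> b - a"
        using total IH(1) uv(3) by simp
    next
      assume "(\<Sum>(t, K)\<in>insert c S. content K) = b - a"
      then have "v = b" and "(\<Sum>(t, K)\<in>S. content K) = u - a"
        using total IH(1) uv(3) by auto
      with IH(2) obtain m x s where P: "tagged_partition_of (m, x, s) a u" "cells (m, x, s) = S"
        by (metis prod_cases3)
      let ?Q = "(Suc m, x(Suc m := v), s(Suc m := t))"
      have "tagged_partition_of ?Q a b"
        using P(1) uv \<open>v = b\<close>
        by (auto simp: tagged_partition_of_def atLeastAtMostSuc_conv)
      moreover have "cells ?Q = insert c S"
      proof -
        have "x m = u"
          using P(1) by (simp add: tagged_partition_of_def)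
        moreover have "{1..Suc m} = insert (Suc m) {1..m}"
          by auto
        ultimately have "cells ?Q = insert c ((\<lambda>i. ((s(Suc m := t)) i,
            {(x(Suc m := v)) (i - 1)..(x(Suc m := v)) i})) ` {1..m})"
          by (simp add: cells_def c)
        also have "\<dots> = insert c (cells (m, x, s))"
          unfolding cells_def prod.case by (intro arg_cong[of _ _ "insert c"] image_cong) auto
        finally show ?thesis
          unfolding P(2) .
      qed
      ultimately show "\<exists>P. tagged_partition_of P a b \<and> cells P = insert c S"
        by blast
    qed
  qed
qed

text \<open>Dropping the degenerate members of a tagged division keeps its total length, so the
  criterion by lengths applies to the rest.\<close>

lemma tagged_division_to_partition:
  fixes D :: "(real \<times> real set) set"
  assumes D: "D tagged_division_of {a..b}" and "a \<le> b"
  obtains P where "tagged_partition_of P a b" and "cells P = {(t, K)\<in>D. content K \<noteq> 0}"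
proof -
  let ?E = "{(t, K)\<in>D. content K \<noteq> 0}"
  have fin: "finite D"
    using D by blast
  have E: "\<exists>u v. a \<le> u \<and> u < v \<and> v \<le> b \<and> K = {u..v} \<and> t \<in> K" if "(t, K) \<in> ?E" for t K
  proof -
    have tK: "(t, K) \<in> D" "content K \<noteq> 0"
      using that by auto
    obtain u v where K: "K = {u..v}"
      using tagged_division_ofD(4)[OF D tK(1)] by auto
    with tK(2) have "u < v"
      by (auto simp: content_real_if split: if_splits)
    then show ?thesis
      using tagged_division_ofD(2,3)[OF D tK(1)] K by auto
  qed
  have "(\<Sum>(t, K)\<in>?E. content K) = (\<Sum>(t, K)\<in>D. content K)"
    using fin by (intro sum.mono_neutral_left) auto
  also have "\<dots> = b - a"
    using additive_content_tagged_division[of D a b] D \<open>a \<le> b\<close> by simp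
  finally have "(\<Sum>(t, K)\<in>?E. content K) = b - a" .
  moreover have "finite ?E"
    by (rule finite_subset[OF _ fin]) auto
  ultimately have "\<exists>P. tagged_partition_of P a b \<and> cells P = ?E"
    using disjoint_intervals_form_partition[of ?E a b, OF _ \<open>a \<le> b\<close> E] tagged_division_ofD(5)[OF D]
    by blast
  then show thesis
    using that by blast
qed

section \<open>Equivalence with the Henstock--Kurzweil integral\<close>

text \<open>If every ball \<open>ball x (\<delta> x)\<close> lies in the open set \<open>\<gamma> x\<close>, then a cell shorter than \<open>\<delta>\<close> at its tag
  lies in \<open>\<gamma>\<close> of the tag, whatever the position of the tag in the cell.\<close>

lemma has_integral_imp_has_seq_henstock_integral:
  assumes f: "(f has_integral A) {a..b}" and "a \<le> b"
  shows "has_seq_henstock_integral f A a b"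
proof -
  have "\<exists>\<delta>. gauge_fun \<delta> a b \<and>
      (\<forall>P. tagged_partition_of P a b \<and> gauge_fine \<delta> P \<longrightarrow> \<bar>riemann_sum f P - A\<bar> < e)"
    if "e > 0" for e
  proof -
    obtain \<gamma> where \<gamma>: "gauge \<gamma>" and close: "\<And>D. D tagged_division_of {a..b} \<Longrightarrow> \<gamma> fine D \<Longrightarrow>
        \<bar>(\<Sum>(t, K)\<in>D. content K *\<^sub>R f t) - A\<bar> < e"
      using f \<open>e > 0\<close> unfolding has_integral_real by (auto simp: real_norm_def)
    have "\<forall>x. \<exists>d>0. ball x d \<subseteq> \<gamma> x"
      using \<gamma> by (meson gauge_def openE)
    then obtain \<delta> where \<delta>: "\<And>x. \<delta> x > 0" "\<And>x. ball x (\<delta> x) \<subseteq> \<gamma> x"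
      by metis
    have "\<bar>riemann_sum f P - A\<bar> < e" if P: "tagged_partition_of P a b" "gauge_fine \<delta> P" for P
    proof (cases "a = b")
      \<comment> \<open>The partition has no cells and is not a tagged division of the point \<open>a\<close>; the Riemann sum and
        the integral both vanish.\<close>
      case True
      have "A = 0"
        using f True has_integral_unique[OF _ has_integral_refl(2)[of f b]] by auto
      moreover have "riemann_sum f P = 0"
      proof -
        obtain m x t where P': "P = (m, x, t)"
          by (cases P)
        have "m = 0"
          using P(1) True division_points_strict_mono[of m x t a b 0 m]
          by (cases m) (auto simp: P' tagged_partition_of_def)
        then show ?thesis
          by (simp add: P' riemann_sum_def)
      qed
      ultimately show ?thesis
        using \<open>e > 0\<close> by simp
    next
      case False
      then have D: "cells P tagged_division_of {a..b}"
        using cells_tagged_division_of P(1) \<open>a \<le> b\<close> by simp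
      have "K \<subseteq> \<gamma> t" if tK: "(t, K) \<in> cells P" for t K
      proof -
        obtain u v where K: "K = {u..v}"
          using tagged_division_ofD(4)[OF D tK] by auto
        have "t \<in> K" "content K < \<delta> t"
          using tagged_division_ofD(2)[OF D tK] gauge_fine_iff_cells[OF P(1)] P(2) tK by auto
        then have "K \<subseteq> ball t (\<delta> t)"
          by (auto simp: K dist_real_def)
        then show ?thesis
          using \<delta>(2) by blast
      qed
      then have "\<gamma> fine cells P"
        by (auto simp: fine_def)
      then show ?thesis
        using close[OF D] riemann_sum_eq_sum_cells[OF P(1)] by simp
    qed
    moreover have "gauge_fun \<delta> a b"
      using \<delta>(1) by (simp add: gauge_fun_def)
    ultimately show ?thesis
      by blast
  qed
  then have "\<forall>n. \<exists>\<delta>. gauge_fun \<delta> a b \<and>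
      (\<forall>P. tagged_partition_of P a b \<and> gauge_fine \<delta> P \<longrightarrow>
        \<bar>riemann_sum f P - A\<bar> < inverse (real (Suc n)))"
    by simp
  then obtain \<delta> where \<delta>: "\<And>n. gauge_fun (\<delta> n) a b"
      "\<And>n P. tagged_partition_of P a b \<Longrightarrow> gauge_fine (\<delta> n) P \<Longrightarrow>
        \<bar>riemann_sum f P - A\<bar> < inverse (real (Suc n))"
    by metis
  have "(\<lambda>n. riemann_sum f (P n)) \<longlonglongrightarrow> A"
    if "\<forall>n. tagged_partition_of (P n) a b \<and> gauge_fine (\<delta> n) (P n)" for P
  proof -
    have "(\<lambda>n. riemann_sum f (P n) - A) \<longlonglongrightarrow> 0"
      using that \<delta>(2)
      by (intro Lim_null_comparison[OF _ LIMSEQ_inverse_real_of_nat] always_eventually)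
        (auto simp: less_imp_le)
    then show ?thesis
      by (simp add: LIM_zero_iff)
  qed
  then show ?thesis
    using \<delta>(1) unfolding has_seq_henstock_integral_def by blast
qed

text \<open>The quantifier exchange at the heart of the equivalence: convergence along every sequence of
  partitions yields one gauge that works for all its fine partitions. Otherwise each gauge of the
  sequence would admit a fine partition with error at least \<open>e\<close>, and these partitions together
  would contradict convergence.\<close>

lemma has_seq_henstock_integral_uniformly_close:
  assumes "has_seq_henstock_integral f A a b" and "e > 0"
  obtains \<delta> where "gauge_fun \<delta> a b"
    and "\<And>P. tagged_partition_of P a b \<Longrightarrow> gauge_fine \<delta> P \<Longrightarrow> \<bar>riemann_sum f P - A\<bar> < e"
proof -
  obtain \<delta> where \<delta>: "\<And>n. gauge_fun (\<delta> n) a b"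
      "\<And>P. (\<And>n. tagged_partition_of (P n) a b \<and> gauge_fine (\<delta> n) (P n)) \<Longrightarrow>
        (\<lambda>n. riemann_sum f (P n)) \<longlonglongrightarrow> A"
    using assms(1) unfolding has_seq_henstock_integral_def by blast
  have "\<exists>n. \<forall>P. tagged_partition_of P a b \<and> gauge_fine (\<delta> n) P \<longrightarrow> \<bar>riemann_sum f P - A\<bar> < e"
  proof (rule ccontr)
    assume "\<not> ?thesis"
    then obtain P where P: "\<And>n. tagged_partition_of (P n) a b \<and> gauge_fine (\<delta> n) (P n)"
        "\<And>n. \<not> \<bar>riemann_sum f (P n) - A\<bar> < e"
      by metis
    from \<delta>(2)[OF P(1)] have "\<forall>\<^sub>F n in sequentially. \<bar>riemann_sum f (P n) - A\<bar> < e"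
      using \<open>e > 0\<close> by (auto simp: tendsto_iff dist_real_def)
    then show False
      using P(2) by simp
  qed
  then show thesis
    using that \<delta>(1) by blast
qed

text \<open>Replacing the cells of a fine tagged division by the nondegenerate ones, arranged as a
  partition, does not change the Riemann sum.\<close>

lemma has_seq_henstock_integral_imp_has_integral:
  assumes f: "has_seq_henstock_integral f A a b" and "a \<le> b"
  shows "(f has_integral A) {a..b}"
  unfolding has_integral_real
proof (intro allI impI)
  fix e :: real assume "e > 0"
  with f obtain \<delta> where \<delta>: "gauge_fun \<delta> a b"
      "\<And>P. tagged_partition_of P a b \<Longrightarrow> gauge_fine \<delta> P \<Longrightarrow> \<bar>riemann_sum f P - A\<bar> < e"
    using has_seq_henstock_integral_uniformly_close by blast
  \<comment> \<open>A cell inside a ball is shorter than the diameter of the ball, hence the radius \<open>\<delta> x / 2\<close>.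
    Outside \<open>[a, b]\<close>, where \<open>\<delta>\<close> need not be positive, any positive radius serves.\<close>
  define \<gamma> where "\<gamma> x = ball x (if x \<in> {a..b} then \<delta> x / 2 else 1)" for x
  have "gauge \<gamma>"
    using \<delta>(1) by (auto simp: gauge_def \<gamma>_def gauge_fun_def)
  moreover have "norm ((\<Sum>(t, K)\<in>D. content K *\<^sub>R f t) - A) < e"
    if D: "D tagged_division_of {a..b}" "\<gamma> fine D" for D
  proof -
    obtain P where P: "tagged_partition_of P a b" "cells P = {(t, K)\<in>D. content K \<noteq> 0}"
      using tagged_division_to_partition D(1) \<open>a \<le> b\<close> by blast
    have "content K < \<delta> t" if tK: "(t, K) \<in> D" "content K \<noteq> 0" for t K
    proof -
      obtain u v where K: "K = {u..v}"
        using tagged_division_ofD(4)[OF D(1) tK(1)] by auto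
      with tK have "u < v"
        by (auto simp: content_real_if split: if_splits)
      have "t \<in> {a..b}"
        using tagged_division_ofD(2,3)[OF D(1) tK(1)] by auto
      then have "\<gamma> t = ball t (\<delta> t / 2)"
        by (simp add: \<gamma>_def)
      then have "{u..v} \<subseteq> ball t (\<delta> t / 2)"
        using fineD[OF D(2) tK(1)] by (simp add: K)
      then have "u \<in> ball t (\<delta> t / 2)" "v \<in> ball t (\<delta> t / 2)"
        using \<open>u < v\<close> by (simp_all only: subset_iff atLeastAtMost_iff order.refl less_imp_le)
      then show ?thesis
        using \<open>u < v\<close> by (simp add: K dist_real_def abs_if split: if_splits)
    qed
    then have "gauge_fine \<delta> P"
      unfolding gauge_fine_iff_cells[OF P(1)] P(2) by auto
    then have "\<bar>riemann_sum f P - A\<bar> < e"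
      using \<delta>(2) P(1) by blast
    moreover have "riemann_sum f P = (\<Sum>(t, K)\<in>D. content K *\<^sub>R f t)"
      unfolding riemann_sum_eq_sum_cells[OF P(1)] P(2)
      using D(1) by (intro sum.mono_neutral_left) auto
    ultimately show ?thesis
      by simp
  qed
  ultimately show "\<exists>\<gamma>. gauge \<gamma> \<and> (\<forall>D. D tagged_division_of {a..b} \<and> \<gamma> fine D \<longrightarrow>
      norm ((\<Sum>(t, K)\<in>D. content K *\<^sub>R f t) - A) < e)"
    by (intro exI[of _ \<gamma>]) simp
qed

lemma has_seq_henstock_integral_iff_has_integral:
  assumes "a \<le> b"
  shows "has_seq_henstock_integral f A a b \<longleftrightarrow> (f has_integral A) {a..b}"
  using assms has_seq_henstock_integral_imp_has_integral has_integral_imp_has_seq_henstock_integral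
  by blast

lemma seq_henstock_integrable_iff_integrable_on:
  assumes "a \<le> b"
  shows "seq_henstock_integrable f a b \<longleftrightarrow> f integrable_on {a..b}"
  using assms
  by (simp add: seq_henstock_integrable_def integrable_on_def
      has_seq_henstock_integral_iff_has_integral)

lemma seq_henstock_integral_eq_integral:
  assumes "a \<le> b" and "f integrable_on {a..b}"
  shows "seq_henstock_integral f a b = integral {a..b} f"
  unfolding seq_henstock_integral_def has_seq_henstock_integral_iff_has_integral[OF assms(1)]
  using assms(2) integrable_integral by (intro the_equality) (auto simp: integral_unique)

section \<open>Monotone convergence\<close>

theorem theorem14:
  fixes a b :: real and f :: "nat \<Rightarrow> real \<Rightarrow> real" and g :: "real \<Rightarrow> real"
  assumes "a \<le> b"
    and "monotone_fun_seq f a b"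
    and "\<And>k. seq_henstock_integrable (f k) a b"
    and "\<And>x. x \<in> {a..b} \<Longrightarrow> (\<lambda>k. f k x) \<longlonglongrightarrow> g x"
    and "convergent (\<lambda>k. seq_henstock_integral (f k) a b)"
  shows "seq_henstock_integrable g a b \<and>
         seq_henstock_integral g a b = lim (\<lambda>k. seq_henstock_integral (f k) a b)"
proof -
  have int: "f k integrable_on {a..b}" for k
    using assms(1,3) seq_henstock_integrable_iff_integrable_on by blast
  then have eq: "seq_henstock_integral (f k) a b = integral {a..b} (f k)" for k
    using assms(1) seq_henstock_integral_eq_integral by blast
  have bounded: "bounded (range (\<lambda>k. integral {a..b} (f k)))"
    using assms(5) by (auto simp: eq convergent_def intro: convergent_imp_bounded)
  have "g integrable_on {a..b} \<and> (\<lambda>k. integral {a..b} (f k)) \<longlonglongrightarrow> integral {a..b} g"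
    using assms(2) unfolding monotone_fun_seq_def
  proof (elim disjE)
    assume "\<forall>k. \<forall>x\<in>{a..b}. f k x \<le> f (Suc k) x"
    then show ?thesis
      using monotone_convergence_increasing[of f "{a..b}" g] int assms(4) bounded by blast
  next
    assume "\<forall>k. \<forall>x\<in>{a..b}. f k x \<ge> f (Suc k) x"
    then show ?thesis
      using monotone_convergence_decreasing[of f "{a..b}" g] int assms(4) bounded by blast
  qed
  then show ?thesis
    using assms(1) limI[of "\<lambda>k. integral {a..b} (f k)" "integral {a..b} g"]
    by (simp add: eq seq_henstock_integrable_iff_integrable_on seq_henstock_integral_eq_integral)
qed

end
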